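(* Let $n \geq 2$ and let $K_n$ be the complete graph on $n$ vertices. Then $\chi_s(S(K_n)) = n+1$.
   Context: All graphs are finite, simple and undirected. A star coloring of a graph $G$ is a proper vertex coloring of $G$ in which every path on four vertices uses at least three distinct colors (equivalently, the union of any two color classes induces a subgraph whose connected components are stars). The star chromatic number $\chi_s(G)$ is the least number of colors in a star coloring of $G$. The splitting graph $S(G)$ of a graph $G$ is obtained from $G$ by adding, for each vertex $v$ of $G$, a new vertex $v'$ whose neighborhood is $N(v')=N(v)$, the neighborhood of $v$ in $G$ (so $v'$ is adjacent exactly to the vertices of $G$ adjacent to $v$; the new vertices are pairwise nonadjacent). *)

theory Defs
  imports "Graph_Theory.Graph_Theory"
begin

text \<open>
  A finite simple undirected graph is a \<^term>\<open>pair_graph\<close>: a finite, symmetric, loop-free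
  digraph without parallel arcs, each edge being represented by its two orientations.
\<close>

definition proper_coloring :: "'a pair_pre_digraph \<Rightarrow> ('a \<Rightarrow> nat) \<Rightarrow> bool" where
  "proper_coloring G c \<longleftrightarrow> (\<forall>(u, v) \<in> parcs G. c u \<noteq> c v)"

definition star_coloring :: "'a pair_pre_digraph \<Rightarrow> ('a \<Rightarrow> nat) \<Rightarrow> bool" where
  "star_coloring G c \<longleftrightarrow> proper_coloring G c \<and>
     (\<forall>p. vpath p (with_proj G) \<and> length p = 4 \<longrightarrow> card (c ` set p) \<ge> 3)"

text \<open>Only the colors taken on vertices of the graph are counted; colorings are total functions.\<close>

definition star_chromatic_number :: "'a pair_pre_digraph \<Rightarrow> nat" where
  "star_chromatic_number G =
     (LEAST k. \<exists>c. star_coloring G c \<and> card (c ` pverts G) = k)"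

text \<open>\<^term>\<open>Inl v\<close> is the original vertex \<open>v\<close>, and \<^term>\<open>Inr v\<close> is its copy \<open>v'\<close>.\<close>

definition splitting_graph :: "'a pair_pre_digraph \<Rightarrow> ('a + 'a) pair_pre_digraph" where
  "splitting_graph G =
     \<lparr> pverts = pverts G <+> pverts G,
       parcs = {(Inl u, Inl v) | u v. (u, v) \<in> parcs G}
             \<union> {(Inl u, Inr v) | u v. (u, v) \<in> parcs G}
             \<union> {(Inr u, Inl v) | u v. (u, v) \<in> parcs G} \<rparr>"

lemma pair_graph_splitting_graph:
  assumes "pair_graph G"
  shows "pair_graph (splitting_graph G)"
proof -
  interpret pair_graph G by fact
  have arcs: "parcs (splitting_graph G) \<subseteq>
      pverts (splitting_graph G) \<times> pverts (splitting_graph G)"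
    by (auto simp: splitting_graph_def dest: wellformed')
  have fin: "finite (pverts (splitting_graph G))"
    by (simp add: splitting_graph_def)
  have sym: "sym (parcs (splitting_graph G))"
    using arcs_symmetric by (auto simp: splitting_graph_def sym_def)
  show ?thesis
  proof
    show "finite (parcs (splitting_graph G))"
      using arcs fin by (meson finite_SigmaI finite_subset)
    show "symmetric (with_proj (splitting_graph G))"
      using sym by (simp add: symmetric_def)
  next
    fix e assume "e \<in> parcs (splitting_graph G)"
    then show "fst e \<noteq> snd e"
      by (auto simp: splitting_graph_def dest: no_loops')
  qed (use arcs fin in auto)
qed

text \<open>A star coloring always exists on a finite graph, so the minimum above is attained.\<close>

lemma star_coloring_exists:
  assumes "pair_graph G"
  shows "\<exists>c. star_coloring G c"
proof -
  interpret pair_graph G by fact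
  obtain c :: "'a \<Rightarrow> nat" where c: "inj_on c (pverts G)"
    using finite_imp_inj_to_nat_seg[OF pair_finite_verts] by blast
  have "proper_coloring G c"
    unfolding proper_coloring_def
    using c no_loops' wellformed' by (fastforce dest: inj_onD)
  moreover have "card (c ` set p) \<ge> 3" if "vpath p (with_proj G)" "length p = 4" for p
  proof -
    have "set p \<subseteq> pverts G" "distinct p"
      using that(1) by (auto simp: vpath_def vwalk_def)
    then have "card (c ` set p) = 4"
      using c that(2) by (metis card_image distinct_card inj_on_subset)
    then show ?thesis by simp
  qed
  ultimately show ?thesis
    unfolding star_coloring_def by blast
qed

end

theory Submission
  imports Defs
begin

text \<open>In a proper coloring a path on four vertices misses having three colors only if its
  colors alternate, which needs two disjoint pairs of equally colored vertices. For the upper bound,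
  give the originals distinct colors and all copies one further color: each such pair then consists
  of copies, but the two pairs are joined by an edge, and copies are never adjacent. For the lower
  bound, the originals form a clique and use \<open>n\<close> colors. If the copies brought no
  further color, each \<open>v'\<close> would have to share the color of \<open>v\<close>, and for
  \<open>u\<close> \<noteq> \<open>v\<close> the path \<open>u'\<close>, \<open>v\<close>,
  \<open>u\<close>, \<open>v'\<close> would alternate between two colors.
  \<open>star_coloringI\<close> and \<open>star_coloringD\<close> reduce star colorings to this
  alternating pattern.\<close>

lemma vpath4_iff:
  "vpath [a, b, c, d] (with_proj G) \<longleftrightarrow>
     {a, b, c, d} \<subseteq> pverts G \<and> {(a, b), (b, c), (c, d)} \<subseteq> parcs G \<and> distinct [a, b, c, d]"
  by (auto simp: vpath_def vwalk_def)

lemma star_coloringD: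
  assumes "star_coloring G f" "{a, b, c, d} \<subseteq> pverts G"
    and "{(a, b), (b, c), (c, d)} \<subseteq> parcs G" "distinct [a, b, c, d]"
  shows "\<not> (f a = f c \<and> f b = f d)"
proof
  assume eq: "f a = f c \<and> f b = f d"
  have "vpath [a, b, c, d] (with_proj G)"
    using assms by (simp add: vpath4_iff)
  then have "card (f ` set [a, b, c, d]) \<ge> 3"
    using assms(1) unfolding star_coloring_def by (elim conjE allE[of _ "[a, b, c, d]"]) simp
  moreover have "f ` set [a, b, c, d] = {f c, f d}"
    using eq by auto
  moreover have "card {f c, f d} \<le> 2"
    by (simp add: card_insert_if)
  ultimately show False
    by simp
qed

text \<open>Consecutive vertices of a path already differ in color by properness, so alternation is
  the only way to stay below three colors, and only that pattern has to be excluded.\<close>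

lemma star_coloringI:
  assumes proper: "\<And>u v. (u, v) \<in> parcs G \<Longrightarrow> f u \<noteq> f v"
    and no_bicolored: "\<And>a b c d. \<lbrakk>(a, b) \<in> parcs G; (b, c) \<in> parcs G; (c, d) \<in> parcs G;
      distinct [a, b, c, d]; {a, b, c, d} \<subseteq> pverts G; f a = f c; f b = f d\<rbrakk> \<Longrightarrow> False"
  shows "star_coloring G f"
  unfolding star_coloring_def proper_coloring_def
proof (intro conjI allI impI)
  fix p assume p: "vpath p (with_proj G) \<and> length p = 4"
  then obtain a b c d where p_eq: "p = [a, b, c, d]"
    by (auto simp: numeral_eq_Suc length_Suc_conv)
  then have path: "{a, b, c, d} \<subseteq> pverts G" "(a, b) \<in> parcs G" "(b, c) \<in> parcs G" "(c, d) \<in> parcs G"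
    "distinct [a, b, c, d]"
    using p by (auto simp: vpath4_iff simp del: distinct.simps)
  have "f a \<noteq> f b" "f b \<noteq> f c" "f c \<noteq> f d"
    using path proper by auto
  moreover have "f a \<noteq> f c \<or> f b \<noteq> f d"
    using no_bicolored path by blast
  ultimately show "3 \<le> card (f ` set p)"
    by (auto simp: p_eq card_insert_if)
qed (use proper in auto)

theorem theorem2:
  fixes n :: nat and G :: "'a pair_pre_digraph"
  assumes "n \<ge> 2" and "complete_digraph n (with_proj G)"
  shows "star_chromatic_number (splitting_graph G) = n + 1"
proof -
  let ?S = "splitting_graph G"
  have fin: "finite (pverts G)" and card: "card (pverts G) = n"
    and arcs: "(u, v) \<in> parcs G \<longleftrightarrow> u \<in> pverts G \<and> v \<in> pverts G \<and> u \<noteq> v" for u v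
    using assms(2) by (auto simp: complete_digraph_pair_def)
  have verts: "pverts ?S = Inl ` pverts G \<union> Inr ` pverts G"
    by (auto simp: splitting_graph_def)
  have S_arcs: "(Inl u, Inl v) \<in> parcs ?S \<longleftrightarrow> (u, v) \<in> parcs G"
    "(Inl u, Inr v) \<in> parcs ?S \<longleftrightarrow> (u, v) \<in> parcs G"
    "(Inr u, Inl v) \<in> parcs ?S \<longleftrightarrow> (u, v) \<in> parcs G"
    "(Inr u, Inr v) \<notin> parcs ?S" for u v
    by (auto simp: splitting_graph_def)
  show ?thesis
    unfolding star_chromatic_number_def
  proof (rule Least_equality)
    obtain g :: "'a \<Rightarrow> nat" where g: "bij_betw g (pverts G) {0..<n}"
      using ex_bij_betw_finite_nat[OF fin] card by auto
    \<comment> \<open>The originals receive the colors below \<open>n\<close>, so \<open>n\<close>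
      is free for the independent set of copies.\<close>
    let ?f = "case_sum g (\<lambda>_. n)"
    have g_inj: "u = v" if "g u = g v" "u \<in> pverts G" "v \<in> pverts G" for u v
      using that g by (auto simp: bij_betw_def dest: inj_onD)
    have g_neq: "g u \<noteq> n" "n \<noteq> g u" if "u \<in> pverts G" for u
      using that g by (auto simp: bij_betw_def)
    \<comment> \<open>Two vertices share a color only if both are copies, so no path uses two repeated colors.\<close>
    have same: "\<exists>x y. u = Inr x \<and> v = Inr y"
      if "?f u = ?f v" "u \<noteq> v" "u \<in> pverts ?S" "v \<in> pverts ?S" for u v
      using that g_inj by (auto simp: verts g_neq)
    have "star_coloring ?S ?f"
    proof (rule star_coloringI)
      fix u v assume "(u, v) \<in> parcs ?S"
      then show "?f u \<noteq> ?f v"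
        using g_inj by (cases u; cases v) (auto simp: S_arcs arcs g_neq)
    next
      fix a b c d
      assume "(a, b) \<in> parcs ?S" "distinct [a, b, c, d]" "{a, b, c, d} \<subseteq> pverts ?S"
        "?f a = ?f c" "?f b = ?f d"
      \<comment> \<open>By \<open>same\<close>, the pair \<open>a\<close>, \<open>c\<close> and the
        pair \<open>b\<close>, \<open>d\<close> would all be copies, yet \<open>a\<close> and
        \<open>b\<close> are adjacent.\<close>
      then show False
        using same[of a c] same[of b d] by (auto simp: S_arcs)
    qed
    moreover have "?f ` pverts ?S = {0..n}"
    proof -
      have "?f ` pverts ?S = g ` pverts G \<union> (\<lambda>_. n) ` pverts G"
        by (simp add: verts image_Un image_image)
      \<comment> \<open>Some copy must exist for the color \<open>n\<close> to be attained.\<close>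
      moreover have "pverts G \<noteq> {}"
        using card \<open>n \<ge> 2\<close> by auto
      ultimately show ?thesis
        using g by (auto simp: bij_betw_def)
    qed
    ultimately show "\<exists>f. star_coloring ?S f \<and> card (f ` pverts ?S) = n + 1"
      by (intro exI[of _ ?f]) simp
  next
    fix k assume "\<exists>f. star_coloring ?S f \<and> card (f ` pverts ?S) = k"
    then obtain f where f: "star_coloring ?S f" and k: "card (f ` pverts ?S) = k"
      by blast
    have proper: "f x \<noteq> f y" if "(x, y) \<in> parcs ?S" for x y
      using f that by (auto simp: star_coloring_def proper_coloring_def)
    let ?L = "f ` Inl ` pverts G"
    \<comment> \<open>The originals induce a complete graph, so properness alone separates their
      colors.\<close>
    have "inj_on (\<lambda>v. f (Inl v)) (pverts G)"
      using proper by (force simp: inj_on_def S_arcs arcs)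
    then have card_L: "card ?L = n"
      by (simp add: card card_image image_image)
    \<comment> \<open>A copy \<open>v'\<close> sees every original vertex but \<open>v\<close>, so if no new color appears it has the color
      of \<open>v\<close>; then \<open>u' v u v'\<close> is a path with two colors.\<close>
    have "\<not> f ` pverts ?S \<subseteq> ?L"
    proof
      assume sub: "f ` pverts ?S \<subseteq> ?L"
      have copy: "f (Inr v) = f (Inl v)" if v: "v \<in> pverts G" for v
      proof -
        have "f (Inr v) \<in> ?L"
          using sub v by (auto simp: verts)
        then obtain w where w: "w \<in> pverts G" "f (Inr v) = f (Inl w)"
          by auto
        then show ?thesis
          using proper[of "Inr v" "Inl w"] v by (auto simp: S_arcs arcs)
      qed
      obtain u v where "u \<in> pverts G" "v \<in> pverts G" "u \<noteq> v"
        using card \<open>n \<ge> 2\<close> by (metis card_le_Suc0_iff_eq fin not_less_eq_eq numeral_2_eq_2)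
      then show False
        using star_coloringD[OF f, of "Inr u" "Inl v" "Inl u" "Inr v"] copy
        by (auto simp: verts S_arcs arcs)
    qed
    then have "?L \<subset> f ` pverts ?S"
      by (auto simp: verts)
    then have "card ?L < card (f ` pverts ?S)"
      using fin by (intro psubset_card_mono) (auto simp: verts)
    then show "n + 1 \<le> k"
      using card_L k by simp
  qed
qed

end
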